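(* Let $\mathcal{F}_{J_0}^J(\eta,\mathcal{Q})=\{\varphi_{J_0,k}:1\le k\le N_{J_0}\}\cup\{\psi_{j,k}^{(s)}:1\le k\le N_{j+1},\ 1\le s\le n\}_{j=J_0}^{J}$ be the truncated spherical framelet system determined by the filter bank $\eta=\{a;b_1,\ldots,b_n\}\subset l_1(\mathbb{Z})$ and the quadrature rules $\mathcal{Q}$ (see context). Assume that the filter bank $\eta$ satisfies the partition of unity condition $$|\hat a(\xi)|^2+\sum_{s=1}^n|\hat b_s(\xi)|^2=1,\qquad \xi\in\mathbb{R},$$ with $\mathrm{supp}\,\hat a\subseteq[0,\frac14]$ and $\mathrm{supp}\,\hat b_s\subseteq[0,\frac12]$ for $s=1,\ldots,n$. Define $\mathcal{V}_j=\mathrm{span}\{\varphi_{j,k}:1\le k\le N_j\}$ and $\mathcal{W}_j=\mathrm{span}\{\psi_{j,k}^{(s)}:1\le k\le N_{j+1},\ 1\le s\le n\}$. Then the following results hold. (i) $\Pi_{t_J}=\mathcal{V}_{J+1}$, and thus $f=\sum_{k=1}^{N_{J+1}}\langle f,\varphi_{J+1,k}\rangle\varphi_{J+1,k}$ for any $f\in\Pi_{t_J}$. (ii) The decomposition and reconstruction relation $\mathcal{V}_{j+1}=\mathcal{V}_j+\mathcal{W}_j$ holds for $j=J_0,\ldots,J$. (iii) The truncated spherical framelet system $\mathcal{F}_{J_0}^J(\eta,\mathcal{Q})$ is a tight frame for $\Pi_{t_J}$. That is, for all $f\in\Pi_{t_J}$, $$f=\sum_{k=1}^{N_{J_0}}\mathsf{v}_{J_0,k}\,\varphi_{J_0,k}+\sum_{j=J_0}^{J}\sum_{k=1}^{N_{j+1}}\sum_{s=1}^n\mathsf{w}_{j,k}^{(s)}\,\psi_{j,k}^{(s)},$$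 where $\mathsf{v}_{j,k}=\langle f,\varphi_{j,k}\rangle$ and $\mathsf{w}_{j,k}^{(s)}=\langle f,\psi_{j,k}^{(s)}\rangle$.
   Context: $Y_\ell^m$ ($\ell\in\mathbb{N}_0$, $|m|\le\ell$) are the standard complex spherical harmonics, an orthonormal basis of $L^2(\mathbb{S}^2)$ (surface measure $\mu_2$, total mass $4\pi$), with $\langle f_1,f_2\rangle=\int_{\mathbb{S}^2}f_1\overline{f_2}\,d\mu_2$. $\mathcal{I}_t=\{(\ell,m):0\le\ell\le t,\ -\ell\le m\le\ell\}$ and $\Pi_t=\mathrm{span}\{Y_\ell^m:(\ell,m)\in\mathcal{I}_t\}$, the polynomials of degree at most $t$ restricted to $\mathbb{S}^2$. A point set $\{\bm{x}_1,\ldots,\bm{x}_N\}\subset\mathbb{S}^2$ is a spherical $t$-design if $\frac1N\sum_{i=1}^Np(\bm{x}_i)=\frac1{4\pi}\int_{\mathbb{S}^2}p\,d\mu_2$ for all $p\in\Pi_t$. Scales: $J_0\le J$ are integers. Quadrature rules: $\mathcal{Q}=\{Q_{N_j,t_j}:j=J_0,\ldots,J+1\}$, where $t_j$ are positive integers with $t_{j+1}=2t_j$, $X_{N_j}=\{\bm{x}_{j,1},\ldots,\bm{x}_{j,N_j}\}\subset\mathbb{S}^2$ is a spherical $t_j$-design, and $Q_{N_j,t_j}=\{(\bm{x}_{j,k},w_{j,k})\}_{k=1}^{N_j}$ with $w_{j,k}\equiv\frac{4\pi}{N_j}$. Filter bank: $l_1(\mathbb{Z})=\{h=\{h_k\}_{k\in\mathbb{Z}}\subset\mathbb{C}:\sum_{k\in\mathbb{Z}}|h_k|<\infty\}$,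 and for a filter $h=\{h_k\}_{k\in\mathbb{Z}}$ its Fourier series is $\hat h(\xi)=\sum_{k\in\mathbb{Z}}h_ke^{-2\pi\mathrm{i}k\xi}$, $\xi\in\mathbb{R}$. With $\lambda_{\ell,m}=\ell$, set $\hat\alpha^{(J+1)}(\frac{\lambda_{\ell,m}}{t_{J+1}})=1$ for $\ell\le t_J$ and $=0$ for $\ell>t_J$, and recursively for $j$ decreasing from $J$ to $J_0$, $$\hat\alpha^{(j)}\Big(\frac{\lambda_{\ell,m}}{t_j}\Big)=\hat a\Big(\frac{\lambda_{\ell,m}}{t_{j+1}}\Big)\hat\alpha^{(j+1)}\Big(\frac{\lambda_{\ell,m}}{t_{j+1}}\Big),\qquad \hat\beta_s^{(j)}\Big(\frac{\lambda_{\ell,m}}{t_j}\Big)=\hat b_s\Big(\frac{\lambda_{\ell,m}}{t_{j+1}}\Big)\hat\alpha^{(j+1)}\Big(\frac{\lambda_{\ell,m}}{t_{j+1}}\Big),\quad s=1,\ldots,n.$$ The framelets are $$\varphi_{j,k}(\bm{x})=\sqrt{w_{j,k}}\sum_{(\ell,m)\in\mathcal{I}_{t_j}}\hat\alpha^{(j)}\Big(\frac{\lambda_{\ell,m}}{t_j}\Big)\overline{Y_\ell^m(\bm{x}_{j,k})}Y_\ell^m(\bm{x}),$$ $$\psi_{j,k}^{(s)}(\bm{x})=\sqrt{w_{j+1,k}}\sum_{(\ell,m)\in\mathcal{I}_{t_{j+1}}}\hat\beta_s^{(j)}\Big(\frac{\lambda_{\ell,m}}{t_j}\Big)\overline{Y_\ell^m(\bm{x}_{j+1,k})}Y_\ell^m(\bm{x}),$$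 with $j=J_0,\ldots,J+1$ for $\varphi_{j,k}$ and $j=J_0,\ldots,J$ for $\psi_{j,k}^{(s)}$. *)

theory Defs
  imports
    "HOL-Analysis.Analysis"
    "HOL-Computational_Algebra.Polynomial"
    "HOL-Library.Function_Algebras"
    "HOL-Library.Set_Algebras"
begin

section \<open>The unit sphere and its surface measure\<close>

typedef sphere2 = "sphere (0 :: real ^ 3) 1"
  morphisms coords Abs_sphere2
  by (rule exI[of _ "axis 1 1"]) (simp add: norm_axis_1)

definition sphere_point :: "real \<Rightarrow> real \<Rightarrow> sphere2" where
  "sphere_point \<theta> \<phi> =
     Abs_sphere2 (vector [sin \<theta> * cos \<phi>, sin \<theta> * sin \<phi>, cos \<theta>])"

text \<open>
  The surface measure is the image of \<open>sin \<theta> d\<theta> d\<phi>\<close> on \<open>[0, \<pi>] \<times> [0, 2\<pi>]\<close> under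
  spherical coordinates.
\<close>

definition mu2 :: "sphere2 measure" where
  "mu2 = distr
     (density (lborel :: (real \<times> real) measure)
       (\<lambda>(\<theta>, \<phi>). ennreal (sin \<theta>) * indicator ({0..pi} \<times> {0..2*pi}) (\<theta>, \<phi>)))
     (vimage_algebra UNIV coords borel)
     (\<lambda>(\<theta>, \<phi>). sphere_point \<theta> \<phi>)"

definition l2_inner :: "(sphere2 \<Rightarrow> complex) \<Rightarrow> (sphere2 \<Rightarrow> complex) \<Rightarrow> complex" where
  "l2_inner f g = (\<integral>y. f y * cnj (g y) \<partial>mu2)"

text \<open>Complex linear span, for the pointwise vector space structure on functions.\<close>

definition cspan :: "(sphere2 \<Rightarrow> complex) set \<Rightarrow> (sphere2 \<Rightarrow> complex) set" where
  "cspan = module.span (\<lambda>c f y. c * f y)"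

section \<open>Spherical harmonics\<close>

text \<open>
  Associated Legendre functions with the Condon-Shortley phase, by the Rodrigues formula
  \<open>P_l^m(z) = (-1)^m / (2^l l!) (1 - z^2)^(m/2) (d/dz)^(l+m) (z^2 - 1)^l\<close>, for \<open>m \<ge> 0\<close>.
\<close>

definition assoc_legendre :: "nat \<Rightarrow> nat \<Rightarrow> real \<Rightarrow> real" where
  "assoc_legendre l m z =
     (-1) ^ m / (2 ^ l * fact l) * sqrt (1 - z\<^sup>2) ^ m
       * poly ((pderiv ^^ (l + m)) ([:-1, 0, 1:] ^ l)) z"

text \<open>
  The longitude of a point is the argument of \<open>x_1 + i x_2\<close>. At the poles, where \<open>Arg 0 = 0\<close> is
  a convention, the associated Legendre factor vanishes unless \<open>m = 0\<close>.
\<close>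

definition sph_harm_nonneg :: "nat \<Rightarrow> nat \<Rightarrow> sphere2 \<Rightarrow> complex" where
  "sph_harm_nonneg l m y =
     of_real (sqrt ((2 * real l + 1) / (4 * pi) * (fact (l - m) / fact (l + m)))
              * assoc_legendre l m (coords y $ 3))
       * cis (real m * Arg (Complex (coords y $ 1) (coords y $ 2)))"

definition sph_harm :: "nat \<Rightarrow> int \<Rightarrow> sphere2 \<Rightarrow> complex" where
  "sph_harm l m y =
     (if 0 \<le> m then sph_harm_nonneg l (nat m) y
      else (-1) ^ nat (- m) * cnj (sph_harm_nonneg l (nat (- m)) y))"

definition harm_index :: "nat \<Rightarrow> (nat \<times> int) set" where
  "harm_index t = (SIGMA l:{0..t}. {- int l..int l})"

definition sph_poly :: "nat \<Rightarrow> (sphere2 \<Rightarrow> complex) set" where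
  "sph_poly t = cspan {sph_harm l m | l m. (l, m) \<in> harm_index t}"

definition spherical_design :: "nat \<Rightarrow> nat \<Rightarrow> (nat \<Rightarrow> sphere2) \<Rightarrow> bool" where
  "spherical_design t N x \<longleftrightarrow> 0 < N \<and>
     (\<forall>p\<in>sph_poly t.
        1 / of_nat N * (\<Sum>i=1..N. p (x i)) = 1 / of_real (4 * pi) * (\<integral>y. p y \<partial>mu2))"

section \<open>Filters\<close>

definition l1Z :: "(int \<Rightarrow> complex) set" where
  "l1Z = {h. (\<lambda>k. cmod (h k)) summable_on UNIV}"

definition fourier :: "(int \<Rightarrow> complex) \<Rightarrow> real \<Rightarrow> complex" where
  "fourier h \<xi> = (\<Sum>\<^sub>\<infinity>k\<in>UNIV. h k * exp (- 2 * of_real pi * \<i> * of_int k * of_real \<xi>))"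

text \<open>
  A Fourier series is 1-periodic, so a nonzero one never has its support on the whole real line
  inside a bounded interval. As usual for framelet filter banks, supports refer to the
  frequency range \<open>[0, 1/2]\<close>, half of the period \<open>[-1/2, 1/2]\<close>. (Neither period \<open>[0, 1]\<close> nor
  \<open>[-1/2, 1/2]\<close> can be meant: supports inside \<open>[0, 1/2]\<close> there contradict the partition of
  unity, which holds on all of the real line.) A bound by \<open>[0, 1/2]\<close> thus holds automatically.
\<close>

definition fourier_supp :: "(int \<Rightarrow> complex) \<Rightarrow> real set" where
  "fourier_supp h = closure {\<xi>\<in>{0..1/2}. fourier h \<xi> \<noteq> 0}"

section \<open>Framelets\<close>

text \<open>
  The functions \<open>\<alpha>^(j)\<close> and \<open>\<beta>_s^(j)\<close> are only ever sampled at the points \<open>l / t_j\<close>, and are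
  represented by these samples: \<open>alpha_hat a t J j l\<close> is the value of \<open>\<alpha>^(j)\<close> at \<open>l / t_j\<close>, and
  \<open>beta_hat a bs t J j l\<close>, with \<open>bs\<close> the filter \<open>b_s\<close>, that of \<open>\<beta>_s^(j)\<close>. Only levels
  \<open>j \<le> J + 1\<close> are meaningful.
\<close>

function alpha_hat :: "(int \<Rightarrow> complex) \<Rightarrow> (int \<Rightarrow> nat) \<Rightarrow> int \<Rightarrow> int \<Rightarrow> nat \<Rightarrow> complex" where
  "alpha_hat a t J j l =
     (if J < j then (if l \<le> t J then 1 else 0)
      else fourier a (real l / real (t (j + 1))) * alpha_hat a t J (j + 1) l)"
  by pat_completeness auto
termination
  by (relation "Wellfounded.measure (\<lambda>(a, t, J, j, l). nat (J + 1 - j))") auto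

declare alpha_hat.simps [simp del]

definition beta_hat ::
  "(int \<Rightarrow> complex) \<Rightarrow> (int \<Rightarrow> complex) \<Rightarrow> (int \<Rightarrow> nat) \<Rightarrow> int \<Rightarrow> int \<Rightarrow> nat \<Rightarrow> complex" where
  "beta_hat a bs t J j l =
     fourier bs (real l / real (t (j + 1))) * alpha_hat a t J (j + 1) l"

definition weight :: "(int \<Rightarrow> nat) \<Rightarrow> int \<Rightarrow> nat \<Rightarrow> real" where
  "weight N j k = 4 * pi / real (N j)"

definition phi ::
  "(int \<Rightarrow> complex) \<Rightarrow> (int \<Rightarrow> nat) \<Rightarrow> (int \<Rightarrow> nat) \<Rightarrow> (int \<Rightarrow> nat \<Rightarrow> sphere2) \<Rightarrow> int \<Rightarrow>
   int \<Rightarrow> nat \<Rightarrow> sphere2 \<Rightarrow> complex" where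
  "phi a t N x J j k y =
     of_real (sqrt (weight N j k)) *
     (\<Sum>(l, m)\<in>harm_index (t j). alpha_hat a t J j l * cnj (sph_harm l m (x j k)) * sph_harm l m y)"

definition psi ::
  "(int \<Rightarrow> complex) \<Rightarrow> (nat \<Rightarrow> int \<Rightarrow> complex) \<Rightarrow> (int \<Rightarrow> nat) \<Rightarrow> (int \<Rightarrow> nat) \<Rightarrow>
   (int \<Rightarrow> nat \<Rightarrow> sphere2) \<Rightarrow> int \<Rightarrow> nat \<Rightarrow> int \<Rightarrow> nat \<Rightarrow> sphere2 \<Rightarrow> complex" where
  "psi a b t N x J s j k y =
     of_real (sqrt (weight N (j + 1) k)) *
     (\<Sum>(l, m)\<in>harm_index (t (j + 1)).
        beta_hat a (b s) t J j l * cnj (sph_harm l m (x (j + 1) k)) * sph_harm l m y)"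

definition V_space ::
  "(int \<Rightarrow> complex) \<Rightarrow> (int \<Rightarrow> nat) \<Rightarrow> (int \<Rightarrow> nat) \<Rightarrow> (int \<Rightarrow> nat \<Rightarrow> sphere2) \<Rightarrow> int \<Rightarrow>
   int \<Rightarrow> (sphere2 \<Rightarrow> complex) set" where
  "V_space a t N x J j = cspan {phi a t N x J j k | k. k \<in> {1..N j}}"

definition W_space ::
  "(int \<Rightarrow> complex) \<Rightarrow> nat \<Rightarrow> (nat \<Rightarrow> int \<Rightarrow> complex) \<Rightarrow> (int \<Rightarrow> nat) \<Rightarrow> (int \<Rightarrow> nat) \<Rightarrow>
   (int \<Rightarrow> nat \<Rightarrow> sphere2) \<Rightarrow> int \<Rightarrow> int \<Rightarrow> (sphere2 \<Rightarrow> complex) set" where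
  "W_space a n b t N x J j =
     cspan {psi a b t N x J s j k | s k. k \<in> {1..N (j + 1)} \<and> s \<in> {1..n}}"

end

theory Submission imports Defs begin

text \<open>
  Both parts of a framelet system are of the form
  \<open>g_k = sqrt (4 pi / N) * sum c_l * cnj (Y_l^m (x_k)) * Y_l^m\<close> with \<open>c_l = 0\<close> unless \<open>2 l \<le> t\<close>,
  where the points \<open>x_k\<close> form a \<open>t\<close>-design. A product \<open>Y_l^m * cnj Y_l'^m'\<close> with \<open>2 l, 2 l' \<le> t\<close> has
  degree at most \<open>t\<close>, so the design integrates it exactly, and the discrete sums inherit the
  orthonormality of the spherical harmonics. Hence the \<open>g_k\<close> span the same space as the \<open>Y_l^m\<close> with
  \<open>c_l \<noteq> 0\<close>, and \<open>sum <f, g_k> g_k\<close> multiplies the \<open>(l, m)\<close> coefficient of \<open>f\<close> by \<open>|c_l|^2\<close>. By the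
  partition of unity, \<open>|\<alpha>^(j)|^2 + sum_s |\<beta>_s^(j)|^2 = |\<alpha>^(j+1)|^2\<close>; this yields the decomposition
  of \<open>V_(j+1)\<close>, and telescopes to the tight frame property.
\<close>

section \<open>Orthogonality of associated Legendre functions\<close>

definition poly_integral :: "real poly \<Rightarrow> real" where
  "poly_integral p = integral {-1..1} (poly p)"

lemma poly_integral_diff: "poly_integral (p - q) = poly_integral p - poly_integral q"
  unfolding poly_integral_def poly_diff
  by (rule Henstock_Kurzweil_Integration.integral_diff)
     (auto intro!: integrable_continuous_interval continuous_intros)

lemma poly_integral_smult: "poly_integral (smult c p) = c * poly_integral p"
  unfolding poly_integral_def poly_smult by simp

lemma poly_integral_0 [simp]: "poly_integral 0 = 0"
  using poly_integral_smult [of 0 0] by simp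

lemma poly_integral_pderiv: "poly_integral (pderiv p) = poly p 1 - poly p (-1)"
  unfolding poly_integral_def
  by (rule integral_unique, rule fundamental_theorem_of_calculus)
     (auto simp: has_real_derivative_iff_has_vector_derivative [symmetric]
           intro!: DERIV_subset [OF poly_DERIV])

lemma poly_integral_by_parts:
  "poly_integral (pderiv p * q) =
     poly (p * q) 1 - poly (p * q) (-1) - poly_integral (p * pderiv q)"
proof -
  have "pderiv p * q = pderiv (p * q) - p * pderiv q"
    by (simp add: pderiv_mult algebra_simps)
  then show ?thesis
    by (simp add: poly_integral_diff poly_integral_pderiv)
qed

text \<open>The assumption makes every boundary term vanish: once \<open>i\<close> derivatives have
  moved to \<open>r\<close>, the next integration by parts leaves the product of the derivatives of
  order \<open>n - 1 - i\<close> of \<open>u\<close> and \<open>i\<close> of \<open>r\<close> at the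
  end points.\<close>

lemma poly_integral_iterated_by_parts:
  assumes "\<And>i c. i < n \<Longrightarrow> c \<in> {-1, 1} \<Longrightarrow>
             poly ((pderiv ^^ (n - 1 - i)) u * (pderiv ^^ i) r) c = 0"
  shows "poly_integral ((pderiv ^^ n) u * r) = (-1) ^ n * poly_integral (u * (pderiv ^^ n) r)"
  using assms
proof (induction n arbitrary: r)
  case (Suc n)
  have boundary: "poly ((pderiv ^^ n) u * r) c = 0" if "c \<in> {-1, 1}" for c
    using Suc.prems [of 0 c] that by simp
  have "poly_integral ((pderiv ^^ n) u * pderiv r)
      = (-1) ^ n * poly_integral (u * (pderiv ^^ n) (pderiv r))"
  proof (rule Suc.IH)
    fix i and c :: real assume "i < n" "c \<in> {-1, 1}"
    then show "poly ((pderiv ^^ (n - 1 - i)) u * (pderiv ^^ i) (pderiv r)) c = 0"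
      using Suc.prems [of "Suc i" c] by (simp add: funpow_swap1)
  qed
  moreover have "poly_integral ((pderiv ^^ Suc n) u * r) = - poly_integral ((pderiv ^^ n) u * pderiv r)"
    using boundary [of 1] boundary [of "-1"]
    by (simp only: funpow.simps comp_apply poly_integral_by_parts) auto
  ultimately show ?case
    by (simp add: funpow_swap1)
qed simp

text \<open>By the product rule, each differentiation costs at most one factor
  \<open>p\<close>.\<close>

lemma higher_pderiv_power_mult:
  fixes p q :: "'a :: idom poly"
  assumes "i \<le> n"
  obtains r where "(pderiv ^^ i) (p ^ n * q) = p ^ (n - i) * r"
proof -
  have "\<exists>r. (pderiv ^^ i) (p ^ n * q) = p ^ (n - i) * r"
    using assms
  proof (induction i)
    case (Suc i)
    then obtain r where r: "(pderiv ^^ i) (p ^ n * q) = p ^ (n - i) * r"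
      by auto
    obtain k where k: "n - i = Suc k"
      using Suc.prems by (cases "n - i") auto
    have "pderiv (p ^ Suc k * r)
        = p ^ k * (p * pderiv r + smult (of_nat (Suc k)) (pderiv p * r))"
      unfolding pderiv_mult pderiv_power_Suc by (simp add: algebra_simps)
    moreover have "n - Suc i = k" using k by simp
    ultimately show ?case by (auto simp: r k)
  qed auto
  with that show ?thesis by blast
qed

lemma higher_pderiv_power_mult_eq_0:
  fixes p q :: "'a :: idom poly"
  assumes "i < n" "poly p c = 0"
  shows "poly ((pderiv ^^ i) (p ^ n * q)) c = 0"
proof -
  obtain r where "(pderiv ^^ i) (p ^ n * q) = p ^ (n - i) * r"
    using higher_pderiv_power_mult [of i n p q] assms by auto
  then show ?thesis using assms by simp
qed

lemma higher_pderiv_degree: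
  fixes p :: "'a :: {comm_semiring_1, semiring_no_zero_divisors, semiring_char_0} poly"
  assumes "degree p \<le> n"
  shows "(pderiv ^^ n) p = [:fact n * coeff p n:]"
proof (rule poly_eqI)
  fix i
  show "coeff ((pderiv ^^ n) p) i = coeff [:fact n * coeff p n:] i"
    using assms
    by (cases i) (auto simp: coeff_higher_pderiv coeff_eq_0 pochhammer_fact)
qed

section \<open>Degrees and leading coefficients of the Legendre factors\<close>

abbreviation (input) legendre_base :: "real poly" where "legendre_base \<equiv> [:-1, 0, 1:]"

text \<open>
  \<open>P_l^m\<close> without the factor \<open>(1 - z^2)^(m/2)\<close> and the normalisation: on the sphere the former
  combines with \<open>exp (i m phi)\<close> to the power \<open>(x_1 + i x_2)^m\<close>.
\<close>

definition legendre_factor :: "nat \<Rightarrow> nat \<Rightarrow> real poly" where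
  "legendre_factor l m = (pderiv ^^ (l + m)) ([:-1, 0, 1:] ^ l)"

lemma degree_legendre_base: "degree (legendre_base ^ l) = 2 * l"
  by (simp add: degree_power_eq)

lemma coeff_legendre_base: "coeff (legendre_base ^ l) (2 * l) = 1"
  using lead_coeff_power [of legendre_base l] by (simp add: degree_legendre_base)

lemma degree_legendre_factor: "degree (legendre_factor l m) = l - m"
  unfolding legendre_factor_def degree_higher_pderiv degree_legendre_base by simp

lemma coeff_legendre_factor:
  assumes "m \<le> l"
  shows "coeff (legendre_factor l m) (l - m) = fact (2 * l) / fact (l - m)"
proof -
  have "pochhammer (real (Suc (l - m))) (l + m) * fact (l - m) = fact (2 * l)"
    using pochhammer_product [of "l - m" "2 * l" "1::real"] assms
    by (simp add: pochhammer_fact algebra_simps)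
  moreover have "l - m + (l + m) = 2 * l" using assms by simp
  ultimately show ?thesis
    unfolding legendre_factor_def coeff_higher_pderiv
    by (simp only: coeff_legendre_base) (simp add: field_simps)
qed

text \<open>The polynomial \<open>z (1 - z^2)^(l + 1)\<close> vanishes at both end points, so its
  derivative integrates to zero; this gives a recursion in \<open>l\<close>.\<close>

lemma poly_integral_power:
  "poly_integral ([:1, 0, -1:] ^ l) = 2 ^ (2 * l + 1) * (fact l)\<^sup>2 / fact (2 * l + 1)"
proof (induction l)
  case 0
  have "poly_integral 1 = poly_integral (pderiv [:0, 1:])" by (simp add: pderiv_pCons one_pCons)
  then show ?case by (simp add: poly_integral_pderiv)
next
  case (Suc l)
  define p :: "real poly" where "p = [:1, 0, -1:]"
  \<comment> \<open>With \<open>p = 1 - z^2\<close>, \<open>z p' = -2 z^2 = 2 p - 2\<close>, so the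
    derivative below becomes a combination of two powers of \<open>p\<close>.\<close>
  have dp: "[:0, 1:] * pderiv p = smult 2 p - [:2:]"
    by (simp add: p_def pderiv_pCons)
  have "pderiv ([:0, 1:] * p ^ Suc l)
      = p ^ Suc l + smult (of_nat (Suc l)) (p ^ l * ([:0, 1:] * pderiv p))"
    unfolding pderiv_mult pderiv_power_Suc by (simp add: pderiv_pCons algebra_simps one_pCons)
  also have "\<dots> = smult (2 * real l + 3) (p ^ Suc l) - smult (2 * real l + 2) (p ^ l)"
  proof -
    have "p ^ l * (smult 2 p - [:2:]) = smult 2 (p ^ Suc l) - smult 2 (p ^ l)"
      by (simp add: right_diff_distrib mult.commute)
    then show ?thesis
      unfolding dp by (intro poly_eqI) (simp add: algebra_simps del: power_Suc)
  qed
  finally have "(2 * real l + 3) * poly_integral (p ^ Suc l) - (2 * real l + 2) * poly_integral (p ^ l)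
      = poly_integral (pderiv ([:0, 1:] * p ^ Suc l))"
    by (simp only: poly_integral_diff poly_integral_smult)
  also have "\<dots> = 0"
    by (simp add: poly_integral_pderiv p_def)
  finally have "poly_integral (p ^ Suc l) = (2 * real l + 2) / (2 * real l + 3) * poly_integral (p ^ l)"
    by (simp add: field_simps)
  also have "\<dots> = 2 ^ (2 * Suc l + 1) * (fact (Suc l))\<^sup>2 / fact (2 * Suc l + 1)"
    unfolding p_def Suc.IH by (simp add: divide_simps power2_eq_square) (simp add: algebra_simps)
  finally show ?case by (simp only: p_def)
qed

text \<open>By symmetry let \<open>l' <= l\<close>. All \<open>l + m\<close> derivatives of the
  Rodrigues formula are moved to \<open>r\<close>, which has degree \<open>l' + m\<close>: they
  annihilate it if \<open>l' < l\<close>, and otherwise leave a constant, so that only the integral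
  of a power of \<open>z^2 - 1\<close> remains.\<close>

lemma legendre_orthogonal:
  assumes m: "m \<le> l" "m \<le> l'"
  shows "poly_integral ([:1, 0, -1:] ^ m * legendre_factor l m * legendre_factor l' m) =
    (if l = l' then 2 / (2 * real l + 1) * (fact (l + m) / fact (l - m)) * (2 ^ l * fact l)\<^sup>2 else 0)"
  using m
proof (induction l' l rule: linorder_wlog)
  case (sym l' l)
  then show ?case by (simp add: mult_ac)
next
  case (le l' l)
  define r where "r = [:1, 0, -1:] ^ m * legendre_factor l' m"
  have sgn: "[:1, 0, -1:] ^ k = smult ((-1) ^ k) (legendre_base ^ k)" for k
    by (simp flip: smult_power)
  have q0: "legendre_factor l' m \<noteq> 0"
    using coeff_legendre_factor [of m l'] le by force
  have degr: "degree r = l' + m"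
    unfolding r_def sgn using le q0
    by (subst degree_mult_eq) (auto simp: degree_legendre_base degree_legendre_factor)
  have parts: "poly_integral ((pderiv ^^ (l + m)) (legendre_base ^ l) * r)
      = (-1) ^ (l + m) * poly_integral (legendre_base ^ l * (pderiv ^^ (l + m)) r)"
  proof (rule poly_integral_iterated_by_parts)
    fix i and c :: real assume i: "i < l + m" and c: "c \<in> {-1, 1}"
    show "poly ((pderiv ^^ (l + m - 1 - i)) (legendre_base ^ l) * (pderiv ^^ i) r) c = 0"
    \<comment> \<open>For \<open>i < m\<close> the factor \<open>(1 - z^2)^m\<close> of
      \<open>r\<close> keeps the end points as roots; from \<open>i = m\<close> on, fewer than
      \<open>l\<close> derivatives are left on \<open>(z^2 - 1)^l\<close>.\<close>
    proof (cases "i < m")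
      case True
      then have "poly ((pderiv ^^ i) r) c = 0"
        unfolding r_def using c by (intro higher_pderiv_power_mult_eq_0) auto
      then show ?thesis by simp
    next
      case False
      then have "poly ((pderiv ^^ (l + m - 1 - i)) (legendre_base ^ l * 1)) c = 0"
        using c i by (intro higher_pderiv_power_mult_eq_0) auto
      then show ?thesis by simp
    qed
  qed
  have eq: "poly_integral ([:1, 0, -1:] ^ m * legendre_factor l m * legendre_factor l' m)
      = poly_integral ((pderiv ^^ (l + m)) (legendre_base ^ l) * r)"
    by (simp add: r_def legendre_factor_def mult_ac)
  show ?case
  proof (cases "l = l'")
    case False
    then have "(pderiv ^^ (l + m)) r = 0"
      using le degr by (subst higher_pderiv_degree) (auto simp: coeff_eq_0)
    then show ?thesis using False parts eq by simp
  next
    case True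
    have "coeff r (l + m) = lead_coeff r" using True degr by simp
    also have "\<dots> = (-1) ^ m * (fact (2 * l) / fact (l - m))"
      unfolding r_def lead_coeff_mult using le True
      by (simp add: lead_coeff_power degree_legendre_factor coeff_legendre_factor)
    finally have "(pderiv ^^ (l + m)) r = [:fact (l + m) * ((-1) ^ m * (fact (2 * l) / fact (l - m))):]"
      using degr True by (subst higher_pderiv_degree) auto
    then have "legendre_base ^ l * (pderiv ^^ (l + m)) r
       = smult ((-1) ^ (l + m) * (fact (l + m) * (fact (2 * l) / fact (l - m)))) ([:1, 0, -1:] ^ l)"
      unfolding sgn by (simp add: power_add mult_ac flip: power_mult_distrib)
    \<comment> \<open>The sign \<open>(-1)^(l + m)\<close> occurs twice, from the integrations by
      parts and from rewriting in \<open>1 - z^2\<close>, and cancels.\<close>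
    then have "poly_integral ((pderiv ^^ (l + m)) (legendre_base ^ l) * r)
       = fact (l + m) * (fact (2 * l) / fact (l - m)) * poly_integral ([:1, 0, -1:] ^ l)"
      using parts by (simp add: poly_integral_smult flip: power_add mult.assoc power_mult_distrib)
    also have "\<dots> = 2 / (2 * real l + 1) * (fact (l + m) / fact (l - m)) * (2 ^ l * fact l)\<^sup>2"
    proof -
      have "(2 ^ l * fact l)\<^sup>2 = (2 ^ (2 * l) * (fact l)\<^sup>2 :: real)"
        by (simp add: power_mult_distrib power_mult [symmetric] mult.commute)
      then show ?thesis
        unfolding poly_integral_power by (simp add: divide_simps)
    qed
    finally show ?thesis unfolding eq using True by simp
  qed
qed

section \<open>Orthonormality of the spherical harmonics\<close>

lemma ex_antiderivative_poly:
  fixes p :: "'a :: field_char_0 poly"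
  obtains q where "pderiv q = p"
proof
  show "pderiv (\<Sum>i\<le>degree p. monom (coeff p i / of_nat (Suc i)) (Suc i)) = p"
    by (simp add: higher_pderiv_sum [of 1, simplified] pderiv_monom poly_as_sum_of_monoms
        del: of_nat_Suc)
qed

text \<open>This is the substitution \<open>z = cos \<theta>\<close>, carried out through the
  antiderivative \<open>- q (cos \<theta>)\<close> with \<open>q' = p\<close>.\<close>

lemma integral_sin_poly_cos:
  "integral {0..pi} (\<lambda>\<theta>. sin \<theta> * poly p (cos \<theta>)) = poly_integral p"
proof -
  obtain q where q: "pderiv q = p" by (rule ex_antiderivative_poly)
  have "((\<lambda>\<theta>. sin \<theta> * poly p (cos \<theta>)) has_integral (- poly q (cos pi) - (- poly q (cos 0)))) {0..pi}"
  proof (rule fundamental_theorem_of_calculus)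
    fix \<theta> :: real assume "\<theta> \<in> {0..pi}"
    show "((\<lambda>\<theta>. - poly q (cos \<theta>)) has_vector_derivative sin \<theta> * poly p (cos \<theta>)) (at \<theta> within {0..pi})"
      unfolding has_real_derivative_iff_has_vector_derivative [symmetric] q [symmetric]
      by (auto intro!: derivative_eq_intros DERIV_chain2 [OF poly_DERIV])
  qed simp
  then show ?thesis
    using q by (simp add: integral_unique flip: poly_integral_pderiv)
qed

lemma integral_cis_of_int:
  "integral {0..2 * pi} (\<lambda>\<phi>. cis (of_int k * \<phi>)) = (if k = 0 then 2 * of_real pi else 0)"
proof (cases "k = 0")
  case False
  have "((\<lambda>\<phi>. cis (of_int k * \<phi>)) has_integral
          (cis (of_int k * (2 * pi)) / (\<i> * of_int k) - cis (of_int k * 0) / (\<i> * of_int k))) {0..2 * pi}"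
  proof (rule fundamental_theorem_of_calculus)
    fix \<phi> :: real
    have "((\<lambda>z. exp (\<i> * (of_int k * z)) / (\<i> * of_int k)) has_field_derivative exp (\<i> * (of_int k * of_real \<phi>)))
            (at (of_real \<phi>))"
      using False by (auto intro!: derivative_eq_intros simp: field_simps)
    from has_vector_derivative_real_field [OF this]
    show "((\<lambda>\<phi>. cis (of_int k * \<phi>) / (\<i> * of_int k)) has_vector_derivative cis (of_int k * \<phi>))
            (at \<phi> within {0..2 * pi})"
      by (simp add: cis_conv_exp)
  qed simp
  moreover have "cis (of_int k * (2 * pi)) = 1"
    using cis_multiple_2pi [of "of_int k"] by (simp add: mult_ac)
  ultimately show ?thesis
    using False by (simp add: integral_unique)
qed (simp add: scaleR_conv_of_real)

section \<open>Spherical coordinates, measurability and product integrals\<close>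

lemma coords_sphere_point:
  "coords (sphere_point \<theta> \<phi>) = vector [sin \<theta> * cos \<phi>, sin \<theta> * sin \<phi>, cos \<theta>]"
proof -
  have "(sin \<theta> * cos \<phi>)\<^sup>2 + (sin \<theta> * sin \<phi>)\<^sup>2 + (cos \<theta>)\<^sup>2 = (sin \<theta>)\<^sup>2 * ((cos \<phi>)\<^sup>2 + (sin \<phi>)\<^sup>2) + (cos \<theta>)\<^sup>2"
    by (simp only: power_mult_distrib distrib_left)
  then show ?thesis
    unfolding sphere_point_def
    by (subst Abs_sphere2_inverse) (auto simp: norm_vec_def L2_set_def sum_3 vector_3)
qed

lemma measurable_coords [measurable]: "(\<lambda>y. coords y $ i) \<in> borel_measurable mu2"
proof -
  have "coords \<in> mu2 \<rightarrow>\<^sub>M borel"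
    by (simp add: mu2_def measurable_vimage_algebra1)
  then show ?thesis
    by (rule measurable_compose) (auto intro!: borel_measurable_continuous_onI continuous_intros)
qed

lemma measurable_sphere_point:
  "(\<lambda>(\<theta>, \<phi>). sphere_point \<theta> \<phi>) \<in> borel \<rightarrow>\<^sub>M vimage_algebra UNIV coords borel"
proof (rule measurable_vimage_algebra2)
  have "(\<lambda>z::real \<times> real. vector [sin (fst z) * cos (snd z), sin (fst z) * sin (snd z), cos (fst z)] :: real ^ 3)
      = (\<lambda>z. \<chi> i. if i = 1 then sin (fst z) * cos (snd z) else
                  if i = 2 then sin (fst z) * sin (snd z) else cos (fst z))"
    by (rule ext) (auto simp: vec_eq_iff forall_3 vector_3)
  also have "\<dots> \<in> borel \<rightarrow>\<^sub>M borel"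
  proof (intro borel_measurable_continuous_onI continuous_on_vec_lambda)
    fix i :: 3
    show "continuous_on UNIV (\<lambda>z. if i = 1 then sin (fst z) * cos (snd z) else
                  if i = 2 then sin (fst z) * sin (snd z) else cos (fst z :: real))"
      by (cases "i = 1"; cases "i = 2") (simp_all add: continuous_intros)
  qed
  finally show "(\<lambda>z. coords (case z of (\<theta>, \<phi>) \<Rightarrow> sphere_point \<theta> \<phi>)) \<in> borel \<rightarrow>\<^sub>M borel"
    by (simp add: coords_sphere_point case_prod_beta)
qed auto

text \<open>In spherical coordinates the integral is one over a compact rectangle with weight
  \<open>sin \<theta>\<close>; continuity gives integrability there, and Fubini splits the
  product.\<close>

lemma has_bochner_integral_mu2_product:
  fixes f :: "real \<Rightarrow> real" and g :: "real \<Rightarrow> complex"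
  assumes h [measurable]: "h \<in> borel_measurable mu2"
    and f: "continuous_on UNIV f" and g: "continuous_on UNIV g"
    and hfg: "\<And>\<theta> \<phi>. h (sphere_point \<theta> \<phi>) = of_real (f \<theta>) * g \<phi>"
  shows "has_bochner_integral mu2 h
    (of_real (integral {0..pi} (\<lambda>\<theta>. sin \<theta> * f \<theta>)) * integral {0..2 * pi} g)"
proof -
  let ?I = "of_real (integral {0..pi} (\<lambda>\<theta>. sin \<theta> * f \<theta>)) * integral {0..2 * pi} g"
  define R where "R = cbox (0::real, 0::real) (pi, 2 * pi)"
  define F where "F = (\<lambda>(\<theta>, \<phi>). of_real (sin \<theta> * f \<theta>) * g \<phi>)"
  \<comment> \<open>A real-valued form of the density of \<open>mu2\<close>, as the Bochner rule for
    densities expects; it is nonnegative because the sine is so on \<open>[0, pi]\<close>.\<close>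
  define d where "d = (\<lambda>z::real \<times> real. indicator R z * sin (fst z))"
  have R: "R = {0..pi} \<times> {0..2 * pi}"
    by (simp add: R_def cbox_Pair_eq)
  have f': "continuous_on S f" and g': "continuous_on S' g" for S S'
    using f g by (auto intro: continuous_on_subset)
  have F: "continuous_on S F" for S
    unfolding F_def case_prod_beta
    by (intro continuous_intros continuous_on_compose2 [OF f] continuous_on_compose2 [OF g]) auto
  have int: "integrable lborel (\<lambda>z. indicator R z *\<^sub>R F z)"
    by (rule borel_integrable_compact) (auto simp: R_def F)
  have "(\<integral>z. indicator R z *\<^sub>R F z \<partial>lborel) = integral R F"
    using set_borel_integral_eq_integral(2) [of R F] int
    by (simp add: set_integrable_def set_lebesgue_integral_def)
  also have "\<dots> = integral {0..pi} (\<lambda>\<theta>. integral {0..2 * pi} (\<lambda>\<phi>. F (\<theta>, \<phi>)))"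
    unfolding R_def by (subst integral_prod_continuous [OF F]) simp
  also have "\<dots> = integral {0..pi} (\<lambda>\<theta>. of_real (sin \<theta> * f \<theta>)) * integral {0..2 * pi} g"
    by (simp add: F_def)
  also have "integral {0..pi} (\<lambda>\<theta>. of_real (sin \<theta> * f \<theta>))
      = (of_real (integral {0..pi} (\<lambda>\<theta>. sin \<theta> * f \<theta>)) :: complex)"
    using integral_linear [of "\<lambda>\<theta>. sin \<theta> * f \<theta>" "{0..pi}" "of_real :: real \<Rightarrow> complex"]
    by (simp add: o_def f' continuous_intros integrable_continuous_interval bounded_linear_of_real
        del: of_real_mult)
  finally have val: "has_bochner_integral lborel (\<lambda>z. indicator R z *\<^sub>R F z) ?I"
    using int by (simp add: has_bochner_integral_iff)
  have meas: "(\<lambda>z. h (case z of (\<theta>, \<phi>) \<Rightarrow> sphere_point \<theta> \<phi>)) \<in> borel_measurable borel"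
    using measurable_compose [OF measurable_sphere_point, of h borel] h
    by (simp add: mu2_def)
  have "has_bochner_integral (density lborel d)
          (\<lambda>z. h (case z of (\<theta>, \<phi>) \<Rightarrow> sphere_point \<theta> \<phi>)) ?I"
  proof (rule has_bochner_integral_density)
    have "(\<lambda>z::real \<times> real. sin (fst z)) \<in> borel_measurable lborel"
      by (auto intro!: borel_measurable_continuous_onI continuous_intros)
    then show "d \<in> borel_measurable lborel"
      unfolding d_def R_def by (intro borel_measurable_times) auto
    show "AE z in lborel. 0 \<le> d z"
      by (auto simp: d_def R indicator_def intro!: sin_ge_zero)
    have "(\<lambda>z. d z *\<^sub>R h (case z of (\<theta>, \<phi>) \<Rightarrow> sphere_point \<theta> \<phi>)) = (\<lambda>z. indicator R z *\<^sub>R F z)"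
      by (auto simp: fun_eq_iff d_def F_def hfg scaleR_conv_of_real)
    then show "has_bochner_integral lborel (\<lambda>z. d z *\<^sub>R h (case z of (\<theta>, \<phi>) \<Rightarrow> sphere_point \<theta> \<phi>)) ?I"
      using val by simp
  qed (use meas in simp)
  moreover have "(\<lambda>(\<theta>, \<phi>). ennreal (sin \<theta>) * indicator ({0..pi} \<times> {0..2*pi}) (\<theta>, \<phi>)) = (\<lambda>z. ennreal (d z))"
    unfolding d_def R by (auto simp: fun_eq_iff indicator_def)
  ultimately show ?thesis
    using h measurable_sphere_point unfolding mu2_def
    by (intro has_bochner_integral_distr) (simp_all add: measurable_distr_eq1)
qed

section \<open>Spherical harmonics as polynomials in x_3 times powers of x_1 + i x_2\<close>

definition equatorial :: "sphere2 \<Rightarrow> complex" where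
  "equatorial y = Complex (coords y $ 1) (coords y $ 2)"

text \<open>This is \<open>(1 - x_3^2)^(|m|/2) exp (i m phi)\<close> without reference to an
  argument, so the poles are not exceptional.\<close>

definition azimuthal :: "int \<Rightarrow> sphere2 \<Rightarrow> complex" where
  "azimuthal m y = (if 0 \<le> m then equatorial y ^ nat m else cnj (equatorial y) ^ nat (- m))"

text \<open>
  For \<open>m < 0\<close> the Condon-Shortley sign cancels against the sign in \<^const>\<open>sph_harm\<close>.
\<close>

definition harm_factor :: "nat \<Rightarrow> int \<Rightarrow> real" where
  "harm_factor l m = (if m < 0 then 1 else (-1) ^ nat m) / (2 ^ l * fact l) *
     sqrt ((2 * real l + 1) / (4 * pi) * (fact (l - nat \<bar>m\<bar>) / fact (l + nat \<bar>m\<bar>)))"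

lemma cmod_equatorial: "(cmod (equatorial y))\<^sup>2 = 1 - (coords y $ 3)\<^sup>2"
proof -
  have "norm (coords y) = 1" using coords [of y] by simp
  then have "(\<Sum>i\<in>UNIV. (coords y $ i)\<^sup>2) = 1"
    by (simp add: norm_vec_def L2_set_def)
  then show ?thesis by (simp add: equatorial_def cmod_power2 sum_3)
qed

text \<open>On the sphere \<open>sqrt (1 - x_3^2)\<close> is the modulus of
  \<open>equatorial y\<close>, so by de Moivre the square root power and the phase combine to a
  power of \<open>equatorial y\<close>.\<close>

lemma sph_harm_eq:
  "sph_harm l m y =
     of_real (harm_factor l m * poly (legendre_factor l (nat \<bar>m\<bar>)) (coords y $ 3)) * azimuthal m y"
proof -
  have "sqrt (1 - (coords y $ 3)\<^sup>2) = cmod (equatorial y)"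
    using cmod_equatorial [of y] by (intro real_sqrt_unique) auto
  then have "of_real (sqrt (1 - (coords y $ 3)\<^sup>2) ^ k) * cis (real k * Arg (equatorial y))
      = rcis (cmod (equatorial y)) (Arg (equatorial y)) ^ k" for k
    by (simp add: rcis_def power_mult_distrib Complex.DeMoivre)
  then have w: "of_real (sqrt (1 - (coords y $ 3)\<^sup>2) ^ k) * cis (real k * Arg (equatorial y))
      = equatorial y ^ k" for k
    by (simp only: rcis_cmod_Arg)
  have nonneg: "sph_harm_nonneg l k y = of_real ((-1) ^ k / (2 ^ l * fact l) *
      sqrt ((2 * real l + 1) / (4 * pi) * (fact (l - k) / fact (l + k))) *
      poly (legendre_factor l k) (coords y $ 3)) * equatorial y ^ k" for k
    unfolding sph_harm_nonneg_def assoc_legendre_def equatorial_def [symmetric] w [symmetric] legendre_factor_def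
    by (simp only: of_real_mult mult_ac)
  show ?thesis
  proof (cases "0 \<le> m")
    case False
    have "(-1) ^ k * ((-1) ^ k * z) = z" for k and z :: complex
      by (simp flip: power_mult_distrib mult.assoc)
    then show ?thesis
      using False unfolding sph_harm_def nonneg harm_factor_def azimuthal_def by simp
  qed (simp add: sph_harm_def nonneg harm_factor_def azimuthal_def)
qed

lemma azimuthal_sphere_point:
  "azimuthal m (sphere_point \<theta> \<phi>) = of_real (sin \<theta> ^ nat \<bar>m\<bar>) * cis (of_int m * \<phi>)"
proof -
  have "equatorial (sphere_point \<theta> \<phi>) = of_real (sin \<theta>) * cis \<phi>"
    by (simp add: equatorial_def coords_sphere_point vector_3 complex_eq_iff)
  then show ?thesis
    by (cases "0 \<le> m") (simp_all add: azimuthal_def power_mult_distrib cis_cnj Complex.DeMoivre)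
qed

lemma measurable_sph_harm [measurable]: "sph_harm l m \<in> borel_measurable mu2"
proof -
  have [measurable]: "equatorial \<in> borel_measurable mu2"
    unfolding equatorial_def Complex_eq by measurable
  have [measurable]: "(\<lambda>y. cnj (equatorial y)) \<in> borel_measurable mu2"
    by (rule measurable_compose [OF _ borel_measurable_continuous_onI]) (auto intro!: continuous_intros)
  have [measurable]: "azimuthal m \<in> borel_measurable mu2"
    unfolding azimuthal_def by (cases "0 \<le> m") simp_all
  have [measurable]: "(\<lambda>y. poly p (coords y $ 3)) \<in> borel_measurable mu2" for p
    by (rule measurable_compose [OF measurable_coords borel_measurable_continuous_onI])
       (auto intro!: continuous_intros)
  show ?thesis unfolding sph_harm_eq [abs_def] by measurable
qed

text \<open>The variables separate. The longitude integral vanishes unless \<open>m = m'\<close>,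
  and in that case the colatitude integral is the one of \<open>legendre_orthogonal\<close>.\<close>

lemma sph_harm_orthonormal:
  assumes "nat \<bar>m\<bar> \<le> l" "nat \<bar>m'\<bar> \<le> l'"
  shows "has_bochner_integral mu2 (\<lambda>y. sph_harm l m y * cnj (sph_harm l' m' y))
           (if l = l' \<and> m = m' then 1 else 0)"
proof -
  define \<mu> where "\<mu> = nat \<bar>m\<bar>"
  define f where "f = (\<lambda>\<theta>. (harm_factor l m * harm_factor l' m') *
    (sin \<theta> ^ (nat \<bar>m\<bar> + nat \<bar>m'\<bar>) * poly (legendre_factor l (nat \<bar>m\<bar>) * legendre_factor l' (nat \<bar>m'\<bar>)) (cos \<theta>)))"
  have [measurable]: "(\<lambda>y. cnj (sph_harm l' m' y)) \<in> borel_measurable mu2"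
    by (rule measurable_compose [OF measurable_sph_harm borel_measurable_continuous_onI])
       (auto intro!: continuous_intros)
  have int: "has_bochner_integral mu2 (\<lambda>y. sph_harm l m y * cnj (sph_harm l' m' y))
     (of_real (integral {0..pi} (\<lambda>\<theta>. sin \<theta> * f \<theta>)) * integral {0..2 * pi} (\<lambda>\<phi>. cis (of_int (m - m') * \<phi>)))"
  proof (rule has_bochner_integral_mu2_product)
    fix \<theta> \<phi>
    have "cis (of_int (m - m') * \<phi>) = cis (of_int m * \<phi>) * cnj (cis (of_int m' * \<phi>))"
      by (simp add: cis_cnj cis_mult algebra_simps)
    then show "sph_harm l m (sphere_point \<theta> \<phi>) * cnj (sph_harm l' m' (sphere_point \<theta> \<phi>)) =
        of_real (f \<theta>) * cis (of_int (m - m') * \<phi>)"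
      by (simp add: sph_harm_eq azimuthal_sphere_point coords_sphere_point vector_3 f_def power_add)
  qed (auto simp: f_def cis_conv_exp intro!: continuous_intros)
  \<comment> \<open>The value \<open>1 / (2 pi)\<close> compensates the longitude integral
    \<open>2 pi\<close> of the constant phase.\<close>
  have "(harm_factor l m)\<^sup>2 * poly_integral ([:1, 0, -1:] ^ \<mu> * legendre_factor l \<mu> * legendre_factor l' \<mu>)
      = (if l = l' then 1 / (2 * pi) else 0)" if "m = m'"
  proof -
    have "(harm_factor l m)\<^sup>2 = (2 * real l + 1) / (4 * pi) * (fact (l - \<mu>) / fact (l + \<mu>)) / (2 ^ l * fact l)\<^sup>2"
      by (simp add: harm_factor_def \<mu>_def power_mult_distrib power_divide power2_eq_square [of "(-1) ^ k" for k]
          flip: power_add)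
    moreover have "poly_integral ([:1, 0, -1:] ^ \<mu> * legendre_factor l \<mu> * legendre_factor l' \<mu>)
        = (if l = l' then 2 / (2 * real l + 1) * (fact (l + \<mu>) / fact (l - \<mu>)) * (2 ^ l * fact l)\<^sup>2 else 0)"
      using assms that by (intro legendre_orthogonal) (simp_all add: \<mu>_def)
    ultimately show ?thesis
      by (simp only: split: if_split) (simp add: divide_simps)
  qed
  moreover have "integral {0..pi} (\<lambda>\<theta>. sin \<theta> * f \<theta>) =
      harm_factor l m * harm_factor l' m *
        poly_integral ([:1, 0, -1:] ^ \<mu> * legendre_factor l \<mu> * legendre_factor l' \<mu>)" if "m = m'"
  proof -
    have "sin \<theta> * f \<theta> = sin \<theta> * poly (smult (harm_factor l m * harm_factor l' m)
        ([:1, 0, -1:] ^ \<mu> * legendre_factor l \<mu> * legendre_factor l' \<mu>)) (cos \<theta>)" for \<theta>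
    proof -
      \<comment> \<open>For \<open>m = m'\<close> the exponent of the sine is even, which makes the
        power a polynomial in the cosine.\<close>
      have "sin \<theta> ^ (\<mu> + \<mu>) = (1 - (cos \<theta>)\<^sup>2) ^ \<mu>"
        by (metis mult_2 power_mult sin_squared_eq)
      then show ?thesis
        using that unfolding f_def \<mu>_def [symmetric] by (simp add: \<mu>_def power2_eq_square)
    qed
    then show ?thesis
      by (simp only: integral_sin_poly_cos poly_integral_smult)
  qed
  ultimately have "integral {0..pi} (\<lambda>\<theta>. sin \<theta> * f \<theta>) = (if l = l' then 1 / (2 * pi) else 0)" if "m = m'"
    using that by (auto simp: power2_eq_square)
  with int show ?thesis
    unfolding integral_cis_of_int by (cases "m = m'") (simp_all split: if_splits)
qed

section \<open>Products of spherical harmonics and exactness of designs\<close>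

interpretation cfun: module "\<lambda>(c::complex) (f::sphere2 \<Rightarrow> complex) y. c * f y"
  by unfold_locales (auto simp: fun_eq_iff algebra_simps)

lemma sum_fun_eq: "(\<Sum>i\<in>A. f i) = (\<lambda>y. \<Sum>i\<in>A. f i y)"
  for f :: "'i \<Rightarrow> 'b \<Rightarrow> 'c :: comm_monoid_add"
  by (induction A rule: infinite_finite_induct) (auto simp: fun_eq_iff)

lemma mem_harm_index: "(l, m) \<in> harm_index t \<longleftrightarrow> l \<le> t \<and> nat \<bar>m\<bar> \<le> l"
  by (auto simp: harm_index_def)

lemma finite_harm_index [simp]: "finite (harm_index t)"
  by (simp add: harm_index_def)

lemma harm_factor_nonzero: "harm_factor l m \<noteq> 0"
proof -
  have "0 < 2 * real l + 1" by simp
  then show ?thesis by (simp add: harm_factor_def)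
qed

text \<open>
  The bound \<open>d\<close> on the number of coefficients, rather than the degree, lets the induction reach the
  zero polynomial; the leading term is removed by the harmonic with \<open>l = |m| + d\<close>, whose
  Legendre factor has degree exactly \<open>d\<close>.
\<close>

lemma azimuthal_poly_in_sph_poly:
  assumes "\<And>i. i \<ge> d \<Longrightarrow> coeff p i = 0" "d + nat \<bar>m\<bar> \<le> Suc t"
  shows "(\<lambda>y. of_real (poly p (coords y $ 3)) * azimuthal m y) \<in> sph_poly t"
  using assms
proof (induction d arbitrary: p)
  case 0
  then have "p = 0" by (simp add: poly_eq_iff)
  then show ?case using cfun.span_zero by (simp add: sph_poly_def cspan_def zero_fun_def)
next
  case (Suc d)
  define l where "l = nat \<bar>m\<bar> + d"
  define q where "q = legendre_factor l (nat \<bar>m\<bar>)"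
  define c where "c = coeff p d / coeff q d"
  have "coeff q d \<noteq> 0"
    using coeff_legendre_factor [of "nat \<bar>m\<bar>" l] by (simp add: q_def l_def)
  have "degree q = d"
    by (simp add: q_def degree_legendre_factor l_def)
  have "(\<lambda>y. of_real (poly (p - smult c q) (coords y $ 3)) * azimuthal m y) \<in> sph_poly t"
  proof (rule Suc.IH)
    fix i assume "d \<le> i"
    then show "coeff (p - smult c q) i = 0"
      using Suc.prems(1) [of i] \<open>coeff q d \<noteq> 0\<close> \<open>degree q = d\<close>
      by (cases "i = d") (auto simp: c_def coeff_eq_0)
  qed (use Suc.prems in simp)
  moreover have "(\<lambda>y. of_real (c / harm_factor l m) * sph_harm l m y) \<in> sph_poly t"
    unfolding sph_poly_def cspan_def using Suc.prems(2)
    by (intro cfun.span_scale cfun.span_base) (auto simp: mem_harm_index l_def intro!: exI [of _ l])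
  ultimately have "(\<lambda>y. of_real (poly (p - smult c q) (coords y $ 3)) * azimuthal m y) +
      (\<lambda>y. of_real (c / harm_factor l m) * sph_harm l m y) \<in> sph_poly t"
    unfolding sph_poly_def cspan_def by (rule cfun.span_add)
  also have "(\<lambda>y. of_real (poly (p - smult c q) (coords y $ 3)) * azimuthal m y) +
      (\<lambda>y. of_real (c / harm_factor l m) * sph_harm l m y) =
      (\<lambda>y. of_real (poly p (coords y $ 3)) * azimuthal m y)"
    using harm_factor_nonzero [of l m]
    by (simp add: fun_eq_iff sph_harm_eq field_simps flip: q_def)
  finally show ?case .
qed

text \<open>On the sphere \<open>x_1 + i x_2\<close> times its conjugate is
  \<open>1 - x_3^2\<close>; pairing off \<open>min i j\<close> such factors leaves a pure
  power.\<close>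

lemma equatorial_power_mult_cnj:
  "equatorial y ^ i * cnj (equatorial y) ^ j =
     of_real ((1 - (coords y $ 3)\<^sup>2) ^ min i j) * azimuthal (int i - int j) y"
proof -
  have w: "equatorial y * cnj (equatorial y) = of_real (1 - (coords y $ 3)\<^sup>2)"
    by (simp only: complex_norm_square [symmetric] cmod_equatorial)
  have pw: "equatorial y ^ k * cnj (equatorial y) ^ k = of_real ((1 - (coords y $ 3)\<^sup>2) ^ k)" for k
    by (simp only: power_mult_distrib [symmetric] w of_real_power)
  show ?thesis
  proof (cases "j \<le> i")
    case True
    then obtain k where k: "i = k + j" by (metis le_add_diff_inverse2)
    have "equatorial y ^ i * cnj (equatorial y) ^ j = (equatorial y ^ j * cnj (equatorial y) ^ j) * equatorial y ^ k"
      by (simp add: k power_add)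
    then show ?thesis
      unfolding pw by (simp add: k azimuthal_def)
  next
    case False
    then obtain k where k: "j = Suc k + i" by (metis less_imp_Suc_add not_le add.commute add_Suc)
    have "equatorial y ^ i * cnj (equatorial y) ^ j = (equatorial y ^ i * cnj (equatorial y) ^ i) * cnj (equatorial y) ^ Suc k"
      by (simp add: k power_add)
    moreover have "azimuthal (int i - int j) y = cnj (equatorial y) ^ Suc k"
    proof -
      have "nat (int k + 1) = Suc k" by simp
      then show ?thesis by (simp add: azimuthal_def k add_ac)
    qed
    moreover have "min i j = i" by (simp add: k)
    ultimately show ?thesis by (simp only: pw)
  qed
qed

lemma azimuthal_eq: "azimuthal m y = equatorial y ^ nat m * cnj (equatorial y) ^ nat (- m)"
  by (simp add: azimuthal_def)

text \<open>The product is a polynomial in \<open>x_3\<close> times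
  \<open>azimuthal (m - m')\<close>. The degree \<open>2 * min i j\<close> of the paired factors
  makes up exactly for the gap between \<open>|m| + |m'|\<close> and \<open>|m - m'|\<close>, so the
  total degree is at most \<open>l + l'\<close>.\<close>

lemma sph_harm_mult_cnj_in_sph_poly:
  assumes m: "nat \<bar>m\<bar> \<le> l" "nat \<bar>m'\<bar> \<le> l'" and t: "l + l' \<le> t"
  shows "(\<lambda>y. sph_harm l m y * cnj (sph_harm l' m' y)) \<in> sph_poly t"
proof -
  \<comment> \<open>\<open>i\<close> and \<open>j\<close> count the factors
    \<open>x_1 + i x_2\<close> and their conjugates; conjugating the second harmonic swaps the two
    roles for \<open>m'\<close>.\<close>
  define i where "i = nat m + nat (- m')"
  define j where "j = nat (- m) + nat m'"
  define p where "p = smult (harm_factor l m * harm_factor l' m')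
    ([:1, 0, -1:] ^ min i j * (legendre_factor l (nat \<bar>m\<bar>) * legendre_factor l' (nat \<bar>m'\<bar>)))"
  \<comment> \<open>One more than the degree bound, since all coefficients from index
    \<open>d\<close> on have to vanish.\<close>
  define d where "d = Suc (2 * min i j + (l - nat \<bar>m\<bar> + (l' - nat \<bar>m'\<bar>)))"
  have ij: "int i - int j = m - m'" by (simp add: i_def j_def)
  have "sph_harm l m y * cnj (sph_harm l' m' y) = of_real (poly p (coords y $ 3)) * azimuthal (m - m') y" for y
  proof -
    have "azimuthal m y * cnj (azimuthal m' y) = equatorial y ^ i * cnj (equatorial y) ^ j"
      by (simp add: azimuthal_eq i_def j_def power_add)
    also have "\<dots> = of_real ((1 - (coords y $ 3)\<^sup>2) ^ min i j) * azimuthal (m - m') y"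
      by (simp only: equatorial_power_mult_cnj ij)
    finally show ?thesis
      by (simp add: sph_harm_eq p_def power2_eq_square)
  qed
  moreover have "(\<lambda>y. of_real (poly p (coords y $ 3)) * azimuthal (m - m') y) \<in> sph_poly t"
  proof (rule azimuthal_poly_in_sph_poly)
    let ?A = "[:1, 0, -1:] ^ min i j :: real poly"
    let ?B = "legendre_factor l (nat \<bar>m\<bar>)" and ?C = "legendre_factor l' (nat \<bar>m'\<bar>)"
    have "degree p \<le> degree (?A * (?B * ?C))"
      unfolding p_def by (rule degree_smult_le)
    also have "\<dots> \<le> degree ?A + degree (?B * ?C)"
      by (rule degree_mult_le)
    also have "\<dots> \<le> degree ?A + (degree ?B + degree ?C)"
      by (intro add_left_mono degree_mult_le)
    also have "degree ?A = 2 * min i j"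
      by (simp add: degree_power_eq)
    finally have "degree p < d"
      unfolding d_def degree_legendre_factor by simp
    then show "coeff p k = 0" if "d \<le> k" for k
      using that by (intro coeff_eq_0) simp
    show "d + nat \<bar>m - m'\<bar> \<le> Suc t"
    proof -
      have arith: "Suc (2 * k + (l - \<mu> + (l' - \<mu>'))) + \<nu> \<le> Suc t"
        if "2 * k + \<nu> = \<mu> + \<mu>'" "\<mu> \<le> l" "\<mu>' \<le> l'" for k \<mu> \<mu>' \<nu>
        using that t by linarith
      have split: "nat k + nat (- k) = nat \<bar>k\<bar>" for k :: int
        by (cases "0 \<le> k") auto
      have "2 * min i j + nat \<bar>int i - int j\<bar> = i + j"
        by (cases "i \<le> j") auto
      also have "i + j = nat \<bar>m\<bar> + nat \<bar>m'\<bar>"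
        using split [of m] split [of m'] unfolding i_def j_def by simp
      finally show ?thesis
        unfolding d_def ij using m by (rule arith)
    qed
  qed
  ultimately show ?thesis by simp
qed

text \<open>The product of the two harmonics has degree at most \<open>t\<close>, so the design
  reproduces its integral.\<close>

lemma spherical_design_orthonormal:
  assumes x: "spherical_design t N x"
    and "nat \<bar>m\<bar> \<le> l" "nat \<bar>m'\<bar> \<le> l'" "l + l' \<le> t"
  shows "of_real (4 * pi / real N) * (\<Sum>k=1..N. sph_harm l m (x k) * cnj (sph_harm l' m' (x k)))
    = (if (l, m) = (l', m') then 1 else 0)"
proof -
  have "1 / of_nat N * (\<Sum>k=1..N. sph_harm l m (x k) * cnj (sph_harm l' m' (x k))) =
      1 / of_real (4 * pi) * (\<integral>y. sph_harm l m y * cnj (sph_harm l' m' y) \<partial>mu2)"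
    using x unfolding spherical_design_def
    by (elim conjE) (rule bspec [OF _ sph_harm_mult_cnj_in_sph_poly [OF assms(2-4)]])
  also have "(\<integral>y. sph_harm l m y * cnj (sph_harm l' m' y) \<partial>mu2) = (if (l, m) = (l', m') then 1 else 0)"
    using has_bochner_integral_integral_eq [OF sph_harm_orthonormal [OF assms(2,3)]] by simp
  finally show ?thesis by (auto simp: field_simps)
qed

lemma sph_poly_expansion:
  assumes "f \<in> sph_poly t"
  obtains F where "f = (\<lambda>y. \<Sum>(l, m)\<in>harm_index t. F (l, m) * sph_harm l m y)"
proof -
  have "\<exists>F. f = (\<lambda>y. \<Sum>(l, m)\<in>harm_index t. F (l, m) * sph_harm l m y)"
    using assms unfolding sph_poly_def cspan_def
  proof (induction rule: cfun.span_induct_alt)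
    case base
    show ?case by (rule exI [of _ "\<lambda>_. 0"]) (simp add: zero_fun_def)
  next
    case (step c g f)
    then obtain l m F where lm: "(l, m) \<in> harm_index t" "g = sph_harm l m"
      and f: "f = (\<lambda>y. \<Sum>(l, m)\<in>harm_index t. F (l, m) * sph_harm l m y)" by blast
    have "(\<Sum>(l', m')\<in>harm_index t. (if (l', m') = (l, m) then c else 0) * sph_harm l' m' y)
        = (\<Sum>i\<in>harm_index t. if i = (l, m) then c * sph_harm l m y else 0)" for y
      by (intro sum.cong) (auto split: if_splits)
    then have "(\<Sum>(l', m')\<in>harm_index t. (if (l', m') = (l, m) then c else 0) * sph_harm l' m' y)
        = c * sph_harm l m y" for y
      using lm(1) by simp
    then show ?case
      unfolding f lm(2)
      by (intro exI [of _ "\<lambda>i. (if i = (l, m) then c else 0) + F i"])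
         (simp add: fun_eq_iff case_prod_unfold distrib_right sum.distrib)
  qed
  then show thesis using that by blast
qed

section \<open>Framelets of a single level\<close>

text \<open>The common form of \<open>phi\<close> and \<open>psi\<close>: \<open>c\<close> stands
  for the samples of either \<open>alpha_hat\<close> or \<open>beta_hat\<close>, and one analysis
  serves both.\<close>

definition framelet :: "(nat \<Rightarrow> complex) \<Rightarrow> nat \<Rightarrow> nat \<Rightarrow> (nat \<Rightarrow> sphere2) \<Rightarrow> nat \<Rightarrow> sphere2 \<Rightarrow> complex" where
  "framelet c t N x k y = of_real (sqrt (4 * pi / real N)) *
     (\<Sum>(l, m)\<in>harm_index t. c l * cnj (sph_harm l m (x k)) * sph_harm l m y)"

lemma phi_eq_framelet: "phi a t N x J j = framelet (alpha_hat a t J j) (t j) (N j) (x j)"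
  by (simp add: fun_eq_iff phi_def framelet_def weight_def)

lemma psi_eq_framelet:
  "psi a b t N x J s j =
     framelet (beta_hat a (b s) t J j) (t (j + 1)) (N (j + 1)) (x (j + 1))"
  by (simp add: fun_eq_iff psi_def framelet_def weight_def)

text \<open>Only the zeros of \<open>c\<close> matter here, not the design, so spans belonging to
  different levels can be compared by inclusions.\<close>

definition band_harmonics :: "(nat \<Rightarrow> complex) \<Rightarrow> (sphere2 \<Rightarrow> complex) set" where
  "band_harmonics c = {sph_harm l m | l m. nat \<bar>m\<bar> \<le> l \<and> c l \<noteq> 0}"

lemma l2_inner_framelet:
  assumes c: "\<And>l. c l \<noteq> 0 \<Longrightarrow> l \<le> t"
  shows "l2_inner (\<lambda>y. \<Sum>(l, m)\<in>harm_index r. F (l, m) * sph_harm l m y) (framelet c t N x k)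
    = (\<Sum>(l, m)\<in>harm_index r. F (l, m) * cnj (c l) * (of_real (sqrt (4 * pi / real N)) * sph_harm l m (x k)))"
proof -
  define w where "w = sqrt (4 * pi / real N)"
  let ?G = "\<lambda>i i'. F i * (of_real w * (cnj (c (fst i')) * sph_harm (fst i') (snd i') (x k)))"
  have "has_bochner_integral mu2
     (\<lambda>y. \<Sum>i\<in>harm_index r. \<Sum>i'\<in>harm_index t.
        ?G i i' * (sph_harm (fst i) (snd i) y * cnj (sph_harm (fst i') (snd i') y)))
     (\<Sum>i\<in>harm_index r. \<Sum>i'\<in>harm_index t. ?G i i' * (if fst i = fst i' \<and> snd i = snd i' then 1 else 0))"
    by (intro has_bochner_integral_sum has_bochner_integral_mult_right sph_harm_orthonormal)
       (auto simp: mem_harm_index)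
  moreover have "(\<Sum>(l, m)\<in>harm_index r. F (l, m) * sph_harm l m y) * cnj (framelet c t N x k y)
     = (\<Sum>i\<in>harm_index r. \<Sum>i'\<in>harm_index t.
        ?G i i' * (sph_harm (fst i) (snd i) y * cnj (sph_harm (fst i') (snd i') y)))" for y
  proof -
    have "cnj (framelet c t N x k y) = (\<Sum>i\<in>harm_index t. of_real w *
        (cnj (c (fst i)) * sph_harm (fst i) (snd i) (x k) * cnj (sph_harm (fst i) (snd i) y)))"
      by (simp add: framelet_def w_def case_prod_unfold sum_distrib_left)
    then show ?thesis
      by (simp only: case_prod_unfold sum_product prod.collapse mult_ac)
  qed
  moreover have "(\<Sum>i'\<in>harm_index t. ?G i i' * (if fst i = fst i' \<and> snd i = snd i' then 1 else 0))
      = F i * cnj (c (fst i)) * (of_real w * sph_harm (fst i) (snd i) (x k))" if "i \<in> harm_index r" for i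
  proof -
    have "(\<Sum>i'\<in>harm_index t. ?G i i' * (if fst i = fst i' \<and> snd i = snd i' then 1 else 0))
        = (\<Sum>i'\<in>harm_index t. if i = i' then ?G i i' else 0)"
      by (intro sum.cong) (auto simp: prod_eq_iff)
    also have "\<dots> = (if i \<in> harm_index t then ?G i i else 0)"
      by (simp add: sum.delta')
    \<comment> \<open>Outside \<open>harm_index t\<close> the coefficient \<open>c (fst i)\<close>
      is zero, and both sides vanish.\<close>
    also have "\<dots> = ?G i i"
      using that c [of "fst i"] by (cases i) (auto simp: mem_harm_index)
    finally show ?thesis by (simp add: mult_ac)
  qed
  ultimately show ?thesis
    unfolding l2_inner_def
    by (simp add: has_bochner_integral_integral_eq case_prod_unfold flip: w_def)
qed

context
  fixes c :: "nat \<Rightarrow> complex" and t N :: nat and x :: "nat \<Rightarrow> sphere2"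
  assumes design: "spherical_design t N x"
    and band: "\<And>l. c l \<noteq> 0 \<Longrightarrow> 2 * l \<le> t"
begin

text \<open>Discrete orthonormality singles out the term \<open>(l, m)\<close> of the sum that
  defines the framelets.\<close>

lemma framelet_quadrature:
  assumes "nat \<bar>m\<bar> \<le> l" "2 * l \<le> t"
  shows "(\<Sum>k=1..N. of_real (sqrt (4 * pi / real N)) * sph_harm l m (x k) * framelet c t N x k y)
    = c l * sph_harm l m y"
proof -
  define w where "w = sqrt (4 * pi / real N)"
  have w: "of_real w * (of_real w * z) = of_real (4 * pi / real N) * (z :: complex)" for z
    by (simp add: w_def flip: of_real_mult mult.assoc)
  have "(\<Sum>k=1..N. of_real w * sph_harm l m (x k) * framelet c t N x k y)
      = (\<Sum>k=1..N. \<Sum>(l', m')\<in>harm_index t. c l' * sph_harm l' m' y *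
          (of_real w * (of_real w * (sph_harm l m (x k) * cnj (sph_harm l' m' (x k))))))"
    unfolding framelet_def w_def [symmetric] case_prod_unfold sum_distrib_left by (simp only: mult_ac)
  also have "\<dots> = (\<Sum>(l', m')\<in>harm_index t. c l' * sph_harm l' m' y *
      (of_real (4 * pi / real N) * (\<Sum>k=1..N. sph_harm l m (x k) * cnj (sph_harm l' m' (x k)))))"
    unfolding w by (subst sum.swap) (simp add: case_prod_unfold sum_distrib_left)
  also have "\<dots> = (\<Sum>i\<in>harm_index t. if i = (l, m) then c l * sph_harm l m y else 0)"
  proof (rule sum.cong [OF refl], clarify)
    fix l' m' assume "(l', m') \<in> harm_index t"
    \<comment> \<open>If \<open>c l'\<close> is nonzero, then \<open>2 * l' <= t\<close>, hence
      \<open>l + l' <= t\<close> and the design is exact; the other summands vanish anyway.\<close>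
    then have "c l' \<noteq> 0 \<Longrightarrow> of_real (4 * pi / real N) * (\<Sum>k=1..N. sph_harm l m (x k) * cnj (sph_harm l' m' (x k)))
        = (if (l, m) = (l', m') then 1 else 0)"
      using assms band [of l'] by (intro spherical_design_orthonormal [OF design]) (auto simp: mem_harm_index)
    then show "c l' * sph_harm l' m' y *
      (of_real (4 * pi / real N) * (\<Sum>k=1..N. sph_harm l m (x k) * cnj (sph_harm l' m' (x k))))
       = (if (l', m') = (l, m) then c l * sph_harm l m y else 0)"
      by (cases "c l' = 0") auto
  qed
  also have "\<dots> = c l * sph_harm l m y"
    using assms by (simp add: mem_harm_index)
  finally show ?thesis by (simp add: w_def)
qed

text \<open>The inner product contributes \<open>cnj (c l)\<close>, the quadrature
  \<open>c l\<close>. The degree \<open>r\<close> of \<open>f\<close> may exceed \<open>t\<close>: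
  the inner products already discard the components with \<open>c l = 0\<close>, and the others lie
  in the band.\<close>

lemma framelet_reconstruction:
  assumes f: "f = (\<lambda>y. \<Sum>(l, m)\<in>harm_index r. F (l, m) * sph_harm l m y)"
  shows "(\<Sum>k=1..N. l2_inner f (framelet c t N x k) * framelet c t N x k y)
    = (\<Sum>(l, m)\<in>harm_index r. of_real ((cmod (c l))\<^sup>2) * (F (l, m) * sph_harm l m y))"
proof -
  have inner: "l2_inner f (framelet c t N x k) = (\<Sum>(l, m)\<in>harm_index r.
      F (l, m) * cnj (c l) * (of_real (sqrt (4 * pi / real N)) * sph_harm l m (x k)))" for k
    unfolding f using band by (intro l2_inner_framelet) fastforce
  have "(\<Sum>k=1..N. l2_inner f (framelet c t N x k) * framelet c t N x k y)
     = (\<Sum>k=1..N. \<Sum>(l, m)\<in>harm_index r. F (l, m) * cnj (c l) *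
         (of_real (sqrt (4 * pi / real N)) * sph_harm l m (x k) * framelet c t N x k y))"
    unfolding inner case_prod_unfold sum_distrib_right
    by (simp only: mult.assoc)
  also have "\<dots> = (\<Sum>(l, m)\<in>harm_index r. F (l, m) * cnj (c l) *
      (\<Sum>k=1..N. of_real (sqrt (4 * pi / real N)) * sph_harm l m (x k) * framelet c t N x k y))"
    by (subst sum.swap) (simp add: case_prod_unfold sum_distrib_left)
  also have "\<dots> = (\<Sum>(l, m)\<in>harm_index r. of_real ((cmod (c l))\<^sup>2) * (F (l, m) * sph_harm l m y))"
  proof (rule sum.cong [OF refl], clarify)
    fix l m assume lm: "(l, m) \<in> harm_index r"
    show "F (l, m) * cnj (c l) * (\<Sum>k=1..N. of_real (sqrt (4 * pi / real N)) * sph_harm l m (x k) * framelet c t N x k y)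
       = of_real ((cmod (c l))\<^sup>2) * (F (l, m) * sph_harm l m y)"
    proof (cases "c l = 0")
      case False
      have "nat \<bar>m\<bar> \<le> l" using lm by (simp add: mem_harm_index)
      from framelet_quadrature [OF this band [OF False]] show ?thesis
        unfolding complex_norm_square by simp
    qed simp
  qed
  finally show ?thesis .
qed

text \<open>One inclusion is the definition of the framelets. For the other,
  \<open>framelet_quadrature\<close> writes \<open>c l\<close> times a harmonic as a combination of
  framelets, and \<open>c l\<close> can be divided out.\<close>

lemma span_framelets: "cspan {framelet c t N x k | k. k \<in> {1..N}} = cspan (band_harmonics c)"
  unfolding cspan_def
proof (rule cfun.span_eq [THEN iffD2], intro conjI subsetI)
  fix g assume "g \<in> {framelet c t N x k | k. k \<in> {1..N}}"
  then obtain k where "g = framelet c t N x k" by blast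
  then have g: "g = (\<Sum>i\<in>harm_index t. (\<lambda>y. (of_real (sqrt (4 * pi / real N)) * c (fst i) *
      cnj (sph_harm (fst i) (snd i) (x k))) * sph_harm (fst i) (snd i) y))"
    unfolding framelet_def [abs_def] sum_fun_eq case_prod_unfold sum_distrib_left
    by (simp only: mult_ac)
  show "g \<in> module.span (\<lambda>c f y. c * f y) (band_harmonics c)"
    unfolding g
  proof (rule cfun.span_sum)
    fix i assume i: "i \<in> harm_index t"
    show "(\<lambda>y. (of_real (sqrt (4 * pi / real N)) * c (fst i) *
        cnj (sph_harm (fst i) (snd i) (x k))) * sph_harm (fst i) (snd i) y)
      \<in> module.span (\<lambda>c f y. c * f y) (band_harmonics c)"
    proof (cases "c (fst i) = 0")
      case True
      then show ?thesis using cfun.span_zero by (simp add: zero_fun_def)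
    next
      case False
      with i have "sph_harm (fst i) (snd i) \<in> band_harmonics c"
        by (cases i) (auto simp: band_harmonics_def mem_harm_index)
      then show ?thesis by (intro cfun.span_scale cfun.span_base)
    qed
  qed
next
  fix g assume "g \<in> band_harmonics c"
  then obtain l m where lm: "nat \<bar>m\<bar> \<le> l" "c l \<noteq> 0" "g = sph_harm l m"
    by (auto simp: band_harmonics_def)
  have "g = (\<lambda>y. inverse (c l) * (c l * sph_harm l m y))"
    using lm by simp
  also have "\<dots> = (\<Sum>k=1..N. (\<lambda>y. (inverse (c l) * (of_real (sqrt (4 * pi / real N)) * sph_harm l m (x k))) * framelet c t N x k y))"
    unfolding framelet_quadrature [OF lm(1) band [OF lm(2)], symmetric] sum_fun_eq sum_distrib_left
    by (simp only: mult.assoc)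
  also have "\<dots> \<in> module.span (\<lambda>c f y. c * f y) {framelet c t N x k | k. k \<in> {1..N}}"
    by (intro cfun.span_sum cfun.span_scale cfun.span_base) blast
  finally show "g \<in> module.span (\<lambda>c f y. c * f y) {framelet c t N x k | k. k \<in> {1..N}}" .
qed

end

section \<open>Framelet filter banks\<close>

text \<open>\<open>fourier_supp\<close> records only frequencies in \<open>[0, 1/2]\<close>, whence
  the range condition.\<close>

lemma fourier_nonzero_le_supp_bound:
  assumes "fourier_supp h \<subseteq> {0..u}" "0 \<le> \<xi>" "\<xi> \<le> 1/2" "fourier h \<xi> \<noteq> 0"
  shows "\<xi> \<le> u"
proof -
  have "\<xi> \<in> fourier_supp h"
    using assms(2-4) closure_subset unfolding fourier_supp_def by fastforce
  with assms(1) show ?thesis by auto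
qed

text \<open>Downward induction from \<open>J + 1\<close>. The bound at level \<open>j + 1\<close>
  puts \<open>l / t (j + 1)\<close> into \<open>[0, 1/2]\<close>, where the support of the low-pass
  filter is controlled; this improves it to \<open>4 * l <= t (j + 1) = 2 * t j\<close>.\<close>

lemma alpha_hat_band:
  assumes j: "J\<^sub>0 \<le> j" "j \<le> J + 1"
    and pos: "\<And>j. j \<in> {J\<^sub>0..J + 1} \<Longrightarrow> 0 < t j"
    and double: "\<And>j. j \<in> {J\<^sub>0..J} \<Longrightarrow> t (j + 1) = 2 * t j"
    and supp: "fourier_supp a \<subseteq> {0..1/4}"
    and "J\<^sub>0 \<le> J" "alpha_hat a t J j l \<noteq> 0"
  shows "2 * l \<le> t j"
proof -
  have "J\<^sub>0 \<le> j \<longrightarrow> alpha_hat a t J j l \<noteq> 0 \<longrightarrow> 2 * l \<le> t j"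
    using j(2)
  proof (induction j rule: int_le_induct)
    \<comment> \<open>At the top, the cut-off \<open>l <= t J\<close> is the claim because
      \<open>t (J + 1) = 2 * t J\<close>.\<close>
    case base
    show ?case using double [of J] \<open>J\<^sub>0 \<le> J\<close> by (simp add: alpha_hat.simps)
  next
    case (step j)
    define i where "i = j - 1"
    show ?case unfolding i_def [symmetric]
    proof (intro impI)
      assume i: "J\<^sub>0 \<le> i" "alpha_hat a t J i l \<noteq> 0"
      have ij: "i \<le> J" "j = i + 1" using step by (simp_all add: i_def)
      then have nz: "fourier a (real l / real (t j)) \<noteq> 0" "alpha_hat a t J j l \<noteq> 0"
        using i(2) by (auto simp: alpha_hat.simps [of a t J i])
      then have "2 * l \<le> t j" using step.IH i ij by simp
      moreover have "0 < t j" using pos [of j] i ij by simp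
      ultimately have "real l / real (t j) \<le> 1/4"
        using nz(1) by (intro fourier_nonzero_le_supp_bound [OF supp]) (auto simp: field_simps)
      then have "4 * l \<le> t j" using \<open>0 < t j\<close> by (simp add: field_simps)
      then show "2 * l \<le> t i" using double [of i] i ij by simp
    qed
  qed
  then show ?thesis using assms by simp
qed

lemma alpha_beta_hat_partition:
  assumes "j \<le> J"
    and "\<And>\<xi>::real. (cmod (fourier a \<xi>))\<^sup>2 + (\<Sum>s=1..n. (cmod (fourier (b s) \<xi>))\<^sup>2) = 1"
  shows "(cmod (alpha_hat a t J j l))\<^sup>2 + (\<Sum>s=1..n. (cmod (beta_hat a (b s) t J j l))\<^sup>2)
    = (cmod (alpha_hat a t J (j + 1) l))\<^sup>2"
proof -
  let ?\<xi> = "real l / real (t (j + 1))"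
  have "(cmod (alpha_hat a t J j l))\<^sup>2 + (\<Sum>s=1..n. (cmod (beta_hat a (b s) t J j l))\<^sup>2)
    = ((cmod (fourier a ?\<xi>))\<^sup>2 + (\<Sum>s=1..n. (cmod (fourier (b s) ?\<xi>))\<^sup>2)) * (cmod (alpha_hat a t J (j + 1) l))\<^sup>2"
    using assms(1) by (simp add: alpha_hat.simps [of a t J j] beta_hat_def norm_mult power_mult_distrib
        sum_distrib_right distrib_right)
  then show ?thesis by (simp only: assms(2) mult_1_left)
qed

text \<open>Descending one level replaces the squared modulus of \<open>alpha_hat\<close> by its
  value one level lower plus the squared moduli of the new \<open>beta_hat\<close>.\<close>

lemma alpha_beta_hat_telescope:
  assumes "j \<le> J"
    and pou: "\<And>\<xi>::real. (cmod (fourier a \<xi>))\<^sup>2 + (\<Sum>s=1..n. (cmod (fourier (b s) \<xi>))\<^sup>2) = 1"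
  shows "(cmod (alpha_hat a t J j l))\<^sup>2 + (\<Sum>i=j..J. \<Sum>s=1..n. (cmod (beta_hat a (b s) t J i l))\<^sup>2)
    = (cmod (alpha_hat a t J (J + 1) l))\<^sup>2"
  using assms(1)
proof (induction j rule: int_le_induct)
  case base
  show ?case using alpha_beta_hat_partition [of J J a b n, OF _ pou] by simp
next
  case (step j)
  have "{j - 1..J} = insert (j - 1) {j..J}" using step by auto
  then show ?case
    using step.IH alpha_beta_hat_partition [of "j - 1" J a b n t l, OF _ pou] step.hyps by simp
qed

theorem theorem4p3:
  fixes J\<^sub>0 J :: int
    and t N :: "int \<Rightarrow> nat"
    and x :: "int \<Rightarrow> nat \<Rightarrow> sphere2"
    and n :: nat
    and a :: "int \<Rightarrow> complex"
    and b :: "nat \<Rightarrow> int \<Rightarrow> complex"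
  assumes "J\<^sub>0 \<le> J"
    and "\<forall>j\<in>{J\<^sub>0..J + 1}. 0 < t j"
    and "\<forall>j\<in>{J\<^sub>0..J}. t (j + 1) = 2 * t j"
    and "\<forall>j\<in>{J\<^sub>0..J + 1}. spherical_design (t j) (N j) (x j)"
    and "a \<in> l1Z"
    and "\<forall>s\<in>{1..n}. b s \<in> l1Z"
    and "\<forall>\<xi>::real. (cmod (fourier a \<xi>))\<^sup>2 + (\<Sum>s=1..n. (cmod (fourier (b s) \<xi>))\<^sup>2) = 1"
    and "fourier_supp a \<subseteq> {0..1/4}"
    and "\<forall>s\<in>{1..n}. fourier_supp (b s) \<subseteq> {0..1/2}"
  shows "(sph_poly (t J) = V_space a t N x J (J + 1) \<and>
      (\<forall>f\<in>sph_poly (t J).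
         f = (\<lambda>y. \<Sum>k=1..N (J + 1).
                l2_inner f (phi a t N x J (J + 1) k) * phi a t N x J (J + 1) k y))) \<and>
    (\<forall>j\<in>{J\<^sub>0..J}. V_space a t N x J (j + 1) = V_space a t N x J j + W_space a n b t N x J j) \<and>
    (\<forall>f\<in>sph_poly (t J).
       f = (\<lambda>y.
         (\<Sum>k=1..N J\<^sub>0. l2_inner f (phi a t N x J J\<^sub>0 k) * phi a t N x J J\<^sub>0 k y) +
         (\<Sum>j=J\<^sub>0..J. \<Sum>k=1..N (j + 1). \<Sum>s=1..n.
            l2_inner f (psi a b t N x J s j k) * psi a b t N x J s j k y)))"
proof -
  let ?\<alpha> = "alpha_hat a t J" and ?\<beta> = "\<lambda>s. beta_hat a (b s) t J"
  have design: "spherical_design (t j) (N j) (x j)" if "J\<^sub>0 \<le> j" "j \<le> J + 1" for j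
    using assms(4) that by simp
  have pou: "(cmod (fourier a \<xi>))\<^sup>2 + (\<Sum>s=1..n. (cmod (fourier (b s) \<xi>))\<^sup>2) = 1" for \<xi>
    using assms(7) by blast
  have \<alpha>_band: "2 * l \<le> t j" if "J\<^sub>0 \<le> j" "j \<le> J + 1" "?\<alpha> j l \<noteq> 0" for j l
    using assms(1-3,8) that by (intro alpha_hat_band [of J\<^sub>0 j J t a]) auto
  \<comment> \<open>\<open>beta_hat\<close> at level \<open>j\<close> has \<open>alpha_hat\<close>
    at level \<open>j + 1\<close> as a factor and inherits its band.\<close>
  have \<beta>_band: "2 * l \<le> t (j + 1)" if "J\<^sub>0 \<le> j" "j \<le> J" "?\<beta> s j l \<noteq> 0" for s j l
    using \<alpha>_band [of "j + 1" l] that by (simp add: beta_hat_def)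
  have \<alpha>_top: "?\<alpha> (J + 1) l = (if l \<le> t J then 1 else 0)" for l
    by (simp add: alpha_hat.simps)
  have V: "V_space a t N x J j = cspan (band_harmonics (?\<alpha> j))" if "J\<^sub>0 \<le> j" "j \<le> J + 1" for j
    unfolding V_space_def phi_eq_framelet using that
    by (intro span_framelets design \<alpha>_band)
  have W: "cspan {psi a b t N x J s j k | k. k \<in> {1..N (j + 1)}} = cspan (band_harmonics (?\<beta> s j))"
    if "J\<^sub>0 \<le> j" "j \<le> J" for s j
    unfolding psi_eq_framelet using that
    by (intro span_framelets design \<beta>_band [of j s]) auto
  \<comment> \<open>The top samples are nonzero exactly for \<open>l <= t J\<close>, so the band
    harmonics are the generators of \<open>sph_poly (t J)\<close>.\<close>
  have "sph_poly (t J) = V_space a t N x J (J + 1)"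
    using assms(1)
    by (auto simp: V sph_poly_def band_harmonics_def \<alpha>_top mem_harm_index conj_commute intro!: arg_cong [of _ _ cspan])
  moreover have "V_space a t N x J (j + 1) = V_space a t N x J j + W_space a n b t N x J j"
    if j: "j \<in> {J\<^sub>0..J}" for j
  proof -
    have j': "J\<^sub>0 \<le> j" "j \<le> J" using j by simp_all
    let ?P = "{psi a b t N x J s j k | s k. k \<in> {1..N (j + 1)} \<and> s \<in> {1..n}}"
    let ?span = "module.span (\<lambda>c (f :: sphere2 \<Rightarrow> complex) y. c * f y)"
    \<comment> \<open>Only the first space is rewritten by harmonics; the second keeps its
      framelets, so that the sum is the span of a union.\<close>
    have "V_space a t N x J j + W_space a n b t N x J j = ?span (band_harmonics (?\<alpha> j) \<union> ?P)"
      using j by (auto simp: V W_space_def cspan_def cfun.span_Un set_plus_def)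
    also have "\<dots> = ?span (band_harmonics (?\<alpha> (j + 1)))"
    proof (rule cfun.span_eq [THEN iffD2], intro conjI subsetI)
      fix g assume "g \<in> band_harmonics (?\<alpha> j) \<union> ?P"
      then consider "g \<in> band_harmonics (?\<alpha> j)"
        | s where "g \<in> {psi a b t N x J s j k | k. k \<in> {1..N (j + 1)}}" by blast
      then show "g \<in> ?span (band_harmonics (?\<alpha> (j + 1)))"
      proof cases
        case 1
        then have "g \<in> band_harmonics (?\<alpha> (j + 1))"
          using j by (auto simp: band_harmonics_def alpha_hat.simps [of a t J j])
        then show ?thesis by (rule cfun.span_base)
      next
        case (2 s)
        then have "g \<in> cspan {psi a b t N x J s j k | k. k \<in> {1..N (j + 1)}}"
          unfolding cspan_def by (rule cfun.span_base)
        then have "g \<in> ?span (band_harmonics (?\<beta> s j))"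
          unfolding W [OF j'] unfolding cspan_def .
        moreover have "band_harmonics (?\<beta> s j) \<subseteq> band_harmonics (?\<alpha> (j + 1))"
          by (auto simp: band_harmonics_def beta_hat_def)
        ultimately show ?thesis using cfun.span_mono by blast
      qed
    next
      fix g assume "g \<in> band_harmonics (?\<alpha> (j + 1))"
      then obtain l m where g: "g = sph_harm l m" "nat \<bar>m\<bar> \<le> l" "?\<alpha> (j + 1) l \<noteq> 0"
        by (auto simp: band_harmonics_def)
      show "g \<in> ?span (band_harmonics (?\<alpha> j) \<union> ?P)"
      proof (cases "?\<alpha> j l = 0")
        case False
        then show ?thesis using g by (intro cfun.span_base) (auto simp: band_harmonics_def)
      next
        case True
        \<comment> \<open>A degree lost by the low-pass filter must survive in some
          \<open>b s\<close> by the partition of unity, and the framelets of that filter recover the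
          harmonic.\<close>
        have "(\<Sum>s=1..n. (cmod (?\<beta> s j l))\<^sup>2) \<noteq> 0"
          using alpha_beta_hat_partition [of j J a b n t l, OF _ pou] True g(3) j by simp
        then obtain s where s: "s \<in> {1..n}" "?\<beta> s j l \<noteq> 0"
          by (metis (no_types, lifting) norm_zero power_zero_numeral sum.neutral)
        then have "g \<in> ?span (band_harmonics (?\<beta> s j))"
          using g by (intro cfun.span_base) (auto simp: band_harmonics_def)
        then have "g \<in> ?span {psi a b t N x J s j k | k. k \<in> {1..N (j + 1)}}"
          using W [OF j', of s] unfolding cspan_def by simp
        moreover have "{psi a b t N x J s j k | k. k \<in> {1..N (j + 1)}} \<subseteq> band_harmonics (?\<alpha> j) \<union> ?P"
          using s by blast
        ultimately show ?thesis using cfun.span_mono by blast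
      qed
    qed
    finally show ?thesis using j by (simp add: V cspan_def)
  qed
  moreover have "f = (\<lambda>y. \<Sum>k=1..N (J + 1).
        l2_inner f (phi a t N x J (J + 1) k) * phi a t N x J (J + 1) k y) \<and>
     f = (\<lambda>y. (\<Sum>k=1..N J\<^sub>0. l2_inner f (phi a t N x J J\<^sub>0 k) * phi a t N x J J\<^sub>0 k y) +
         (\<Sum>j=J\<^sub>0..J. \<Sum>k=1..N (j + 1). \<Sum>s=1..n.
            l2_inner f (psi a b t N x J s j k) * psi a b t N x J s j k y))"
    if f: "f \<in> sph_poly (t J)" for f
  proof -
    obtain F where F: "f = (\<lambda>y. \<Sum>(l, m)\<in>harm_index (t J). F (l, m) * sph_harm l m y)"
      using sph_poly_expansion [OF f] .
    have one: "cmod (?\<alpha> (J + 1) l) = 1" if "(l, m) \<in> harm_index (t J)" for l m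
      using that by (simp add: \<alpha>_top mem_harm_index)
    have \<phi>: "(\<Sum>k=1..N j. l2_inner f (phi a t N x J j k) * phi a t N x J j k y)
       = (\<Sum>(l, m)\<in>harm_index (t J). of_real ((cmod (?\<alpha> j l))\<^sup>2) * (F (l, m) * sph_harm l m y))"
      if "J\<^sub>0 \<le> j" "j \<le> J + 1" for j y
      unfolding phi_eq_framelet using that
      by (intro framelet_reconstruction [OF _ _ F] design \<alpha>_band)
    \<comment> \<open>For fixed \<open>s\<close> the sum over \<open>k\<close> is a framelet
      reconstruction with the design of level \<open>j + 1\<close>; hence the exchange of
      sums.\<close>
    have \<psi>: "(\<Sum>k=1..N (j + 1). \<Sum>s=1..n. l2_inner f (psi a b t N x J s j k) * psi a b t N x J s j k y)
       = (\<Sum>s=1..n. \<Sum>(l, m)\<in>harm_index (t J). of_real ((cmod (?\<beta> s j l))\<^sup>2) * (F (l, m) * sph_harm l m y))"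
      if "J\<^sub>0 \<le> j" "j \<le> J" for j y
      unfolding psi_eq_framelet using that
      by (subst sum.swap)
         (intro sum.cong [OF refl] framelet_reconstruction [OF _ _ F] design \<beta>_band, auto)
    have "f y = (\<Sum>k=1..N (J + 1). l2_inner f (phi a t N x J (J + 1) k) * phi a t N x J (J + 1) k y)" for y
      using assms(1) by (subst \<phi>) (auto simp: F one intro!: sum.cong)
    moreover have "f y = (\<Sum>k=1..N J\<^sub>0. l2_inner f (phi a t N x J J\<^sub>0 k) * phi a t N x J J\<^sub>0 k y) +
         (\<Sum>j=J\<^sub>0..J. \<Sum>k=1..N (j + 1). \<Sum>s=1..n.
            l2_inner f (psi a b t N x J s j k) * psi a b t N x J s j k y)" (is "_ = ?R") for y
    proof -
      have "?R = (\<Sum>(l, m)\<in>harm_index (t J). of_real ((cmod (?\<alpha> J\<^sub>0 l))\<^sup>2) * (F (l, m) * sph_harm l m y)) +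
         (\<Sum>j=J\<^sub>0..J. \<Sum>s=1..n. \<Sum>(l, m)\<in>harm_index (t J). of_real ((cmod (?\<beta> s j l))\<^sup>2) * (F (l, m) * sph_harm l m y))"
        using assms(1) by (intro arg_cong2 [of _ _ _ _ "(+)"] sum.cong refl \<phi> \<psi>) auto
      \<comment> \<open>Collecting the factors of each component of \<open>f\<close> produces the
        telescoping sum, which equals 1 for \<open>l <= t J\<close>.\<close>
      also have "\<dots> = (\<Sum>(l, m)\<in>harm_index (t J). of_real ((cmod (?\<alpha> J\<^sub>0 l))\<^sup>2 +
           (\<Sum>j=J\<^sub>0..J. \<Sum>s=1..n. (cmod (?\<beta> s j l))\<^sup>2)) * (F (l, m) * sph_harm l m y))"
        by (simp only: case_prod_unfold of_real_add of_real_sum distrib_right sum.distrib sum_distrib_right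
            sum.swap [of _ "harm_index (t J)" "{1..n}"] sum.swap [of _ "harm_index (t J)" "{J\<^sub>0..J}"])
      also have "\<dots> = f y"
        unfolding alpha_beta_hat_telescope [OF assms(1) pou] F
        by (auto simp: one intro!: sum.cong)
      finally show ?thesis ..
    qed
    ultimately show ?thesis by blast
  qed
  ultimately show ?thesis by blast
qed

end
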